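(* Let $\alpha\in[0,1]$. The number $r_{\mathcal{S}}(\alpha)$, i.e. the $\mathcal{S}$-radius in $\mathcal{N}(\alpha)$, is the root in $(0,1)$ of the equation $$2(1-r)^{3}+(2\alpha-1)r-1=0.$$ The extremal function is $$g(z)=2z-\frac{\alpha z}{1-z}-\frac{(1-\alpha)z}{(1-z)^{2}},\quad z\in\mathbb{D},$$ that is, $g\in\mathcal{N}(\alpha)$ and $g$ is not univalent in $|z|<r$ for any $r>r_{\mathcal{S}}(\alpha)$ (with $r\le 1$).
   Context: $\mathbb{D}=\{z\in\mathbb{C}:|z|<1\}$. $\mathcal{A}$ is the set of all analytic functions $f$ in $\mathbb{D}$ of the form $f(z)=z+\sum_{n=2}^{\infty}a_nz^n$, and $\mathcal{S}$ is the class of univalent (injective) functions in $\mathcal{A}$. For $\alpha\in[0,1]$, $$\mathcal{N}(\alpha)=\left\{f_\alpha:\ f_\alpha(z)=(1-\alpha)f(z)+\alpha\int_0^z\frac{f(t)}{t}\,dt,\ f\in\mathcal{A}\text{ with }|a_n|\leq n\text{ for all }n\geq 2\right\},$$ where $a_n$ are the Taylor coefficients of $f$. For subclasses $\mathcal{F},\mathcal{G}\subset\mathcal{A}$, the $\mathcal{G}$-radius in $\mathcal{F}$, denoted $r_{\mathcal{G}}(\mathcal{F})$, is the largest $r_0$ such that for every $f\in\mathcal{F}$ the function $G_r(z)=r^{-1}f(rz)$ belongs to $\mathcal{G}$ for all $0<r\leq r_0$. We write $r_{\mathcal{S}}(\alpha):=r_{\mathcal{S}}(\mathcal{N}(\alpha))$.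 *)

theory Defs
  imports "HOL-Complex_Analysis.Complex_Analysis"
begin

abbreviation unit_disc :: "complex set" where
  "unit_disc \<equiv> ball 0 1"

definition taylor_coeff :: "(complex \<Rightarrow> complex) \<Rightarrow> nat \<Rightarrow> complex" where
  "taylor_coeff f n = fps_nth (fps_expansion f 0) n"

(* Functions on the unit disc are represented by total functions; all classes below
   depend only on the values on the unit disc. *)

definition class_A :: "(complex \<Rightarrow> complex) set" where
  "class_A = {f. f holomorphic_on unit_disc \<and>
     (\<forall>z\<in>unit_disc. (\<lambda>n. taylor_coeff f (n + 2) * z ^ (n + 2)) sums (f z - z))}"

definition class_S :: "(complex \<Rightarrow> complex) set" where
  "class_S = {f \<in> class_A. inj_on f unit_disc}"

(* The integrand f t / t takes the value 0 instead of its limit 1 at t = 0 (division by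
   zero), which does not affect the integral. *)

definition class_N :: "real \<Rightarrow> (complex \<Rightarrow> complex) set" where
  "class_N \<alpha> = {F. \<exists>f\<in>class_A. (\<forall>n\<ge>2. cmod (taylor_coeff f n) \<le> real n) \<and>
     (\<forall>z\<in>unit_disc. F z = (1 - of_real \<alpha>) * f z
        + of_real \<alpha> * contour_integral (linepath 0 z) (\<lambda>t. f t / t))}"

definition dilation :: "real \<Rightarrow> (complex \<Rightarrow> complex) \<Rightarrow> complex \<Rightarrow> complex" where
  "dilation r f z = f (of_real r * z) / of_real r"

(* The bound r0 \<le> 1 is what makes the dilations of a function on the unit disc
   meaningful on the whole unit disc. *)

definition radius_admissible ::
    "(complex \<Rightarrow> complex) set \<Rightarrow> (complex \<Rightarrow> complex) set \<Rightarrow> real \<Rightarrow> bool" where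
  "radius_admissible G F r0 \<longleftrightarrow> 0 \<le> r0 \<and> r0 \<le> 1 \<and>
     (\<forall>f\<in>F. \<forall>r. 0 < r \<and> r \<le> r0 \<longrightarrow> dilation r f \<in> G)"

definition is_radius ::
    "(complex \<Rightarrow> complex) set \<Rightarrow> (complex \<Rightarrow> complex) set \<Rightarrow> real \<Rightarrow> bool" where
  "is_radius G F r0 \<longleftrightarrow>
     radius_admissible G F r0 \<and> (\<forall>s. radius_admissible G F s \<longrightarrow> s \<le> r0)"

(* Meaningful only if the largest admissible number exists; see is_radius. *)

definition radius ::
    "(complex \<Rightarrow> complex) set \<Rightarrow> (complex \<Rightarrow> complex) set \<Rightarrow> real" where
  "radius G F = (THE r0. is_radius G F r0)"

definition r_S :: "real \<Rightarrow> real" where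
  "r_S \<alpha> = radius class_S (class_N \<alpha>)"

definition extremal :: "real \<Rightarrow> complex \<Rightarrow> complex" where
  "extremal \<alpha> z = 2 * z - of_real \<alpha> * z / (1 - z) - (1 - of_real \<alpha>) * z / (1 - z) ^ 2"

end

theory Submission
  imports Defs
begin

text \<open>
  The proof is a comparison of power series. Integrating \<open>f t / t\<close> divides the \<open>n\<close>-th Taylor
  coefficient by \<open>n\<close>, so a function in \<open>class_N \<alpha>\<close> has coefficients
  \<open>b\<^sub>n = (1 - \<alpha> + \<alpha> / n) a\<^sub>n\<close>, whence \<open>\<bar>b\<^sub>n\<bar> \<le> c\<^sub>n\<close> for
  \<open>c\<^sub>n = (1 - \<alpha>) n + \<alpha>\<close> and \<open>n \<ge> 2\<close>, with \<open>b\<^sub>1 = c\<^sub>1 = 1\<close>.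
  Let \<open>M(x) = \<Sum> n c\<^sub>n x\<^sup>n\<^sup>-\<^sup>1\<close>. Comparing the derivatives term by term gives
  \<open>\<bar>F'(z) - 1\<bar> \<le> M(\<bar>z\<bar>) - 1\<close> (lemma \<open>cmod_deriv_minus_one_le\<close>), so as long as \<open>M < 2\<close>
  the map \<open>F\<close> is the identity plus a strict contraction, hence injective.

  The sum \<open>M\<close> has a closed form, and \<open>(1 - x)\<^sup>3 (2 - M(x))\<close> is exactly the cubic of the theorem.
  Since \<open>M\<close> increases from \<open>1\<close> and passes \<open>2\<close> before \<open>1/2\<close>, the cubic has a single root in the
  unit interval, and every member of the class is injective on the disc of that radius.

  The bound is sharp because the extremal function has the coefficients \<open>-c\<^sub>n\<close> for \<open>n \<ge> 2\<close>:
  its derivative on the real axis is \<open>2 - M(x)\<close>, which vanishes at the root, and an injective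
  holomorphic function on an open set has no critical point.
\<close>

section \<open>The classes in terms of power series\<close>

lemma power_series_on_disc:
  assumes sums: "\<And>z. cmod z < 1 \<Longrightarrow> (\<lambda>n. a n * z ^ n) sums f z"
  shows "f holomorphic_on unit_disc" and "taylor_coeff f n = a n"
proof -
  define A where "A = Abs_fps a"
  have "fps_conv_radius A \<ge> 1"
    unfolding fps_conv_radius_def A_def fps_nth_Abs_fps one_ereal_def
  proof (rule conv_radius_geI_ex')
    fix r :: real assume "0 < r" "ereal r < ereal 1"
    then show "summable (\<lambda>n. a n * of_real r ^ n)"
      using sums[of "of_real r"] by (auto simp: sums_iff)
  qed
  then have "ereal (cmod z) < fps_conv_radius A" if "cmod z < 1" for z
    by (rule less_le_trans[rotated]) (use that in simp)
  then have sub: "unit_disc \<subseteq> eball 0 (fps_conv_radius A)"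
    by auto
  have eval: "eval_fps A z = f z" if "cmod z < 1" for z
    using sums[OF that] by (simp add: eval_fps_def A_def sums_iff)
  have "eval_fps A holomorphic_on unit_disc"
    using sub by (intro holomorphic_on_eval_fps) auto
  then show "f holomorphic_on unit_disc"
    by (rule holomorphic_transform) (simp add: eval)
  have "\<forall>\<^sub>F z in nhds 0. eval_fps A z = f z"
    using eventually_nhds_in_open[of unit_disc 0] by (rule eventually_mono[rotated 2]) (auto simp: eval)
  moreover have "fps_conv_radius A > 0"
    using \<open>fps_conv_radius A \<ge> 1\<close> by (rule less_le_trans[rotated]) simp
  ultimately have "f has_fps_expansion A"
    by (simp add: has_fps_expansion_def)
  then show "taylor_coeff f n = a n"
    by (simp add: taylor_coeff_def fps_expansion_eqI A_def)
qed

lemma deriv_power_series_on_disc: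
  assumes sums: "\<And>z. cmod z < 1 \<Longrightarrow> (\<lambda>n. a n * z ^ n) sums f z" and z: "cmod z < 1"
  shows "(f has_field_derivative deriv f z) (at z)"
    and "(\<lambda>n. diffs a n * z ^ n) sums deriv f z"
proof -
  have "f holomorphic_on unit_disc"
    using power_series_on_disc(1) sums by blast
  then show D: "(f has_field_derivative deriv f z) (at z)"
    using z by (intro holomorphic_derivI) auto
  show "(\<lambda>n. diffs a n * z ^ n) sums deriv f z"
    using sums D z by (rule termdiffs_sums_strong)
qed

lemma class_A_iff_power_series:
  "f \<in> class_A \<longleftrightarrow>
     (\<exists>a. a 0 = 0 \<and> a 1 = 1 \<and> (\<forall>z. cmod z < 1 \<longrightarrow> (\<lambda>n. a n * z ^ n) sums f z))"
    (is "_ \<longleftrightarrow> (\<exists>a. ?P a)")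
proof
  assume f: "f \<in> class_A"
  define a where "a n = (if n < 2 then of_nat n else taylor_coeff f n)" for n
  have "(\<lambda>n. a n * z ^ n) sums f z" if "cmod z < 1" for z
  proof -
    have "(\<lambda>n. a (n + 2) * z ^ (n + 2)) sums (f z - z)"
      using f that by (simp add: class_A_def a_def)
    then show ?thesis
      by (subst (asm) sums_iff_shift) (simp add: a_def numeral_2_eq_2)
  qed
  then have "?P a" by (simp add: a_def)
  then show "\<exists>a. ?P a" by blast
next
  assume "\<exists>a. ?P a"
  then obtain a where a: "?P a" by blast
  have sums: "(\<lambda>n. a n * z ^ n) sums f z" if "cmod z < 1" for z
    using a that by blast
  have "(\<lambda>n. a (n + 2) * z ^ (n + 2)) sums (f z - z)" if "cmod z < 1" for z
    using sums[OF that] a by (subst sums_iff_shift) (simp add: numeral_2_eq_2)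
  then show "f \<in> class_A"
    using power_series_on_disc[of a f, OF sums] by (simp add: class_A_def)
qed

text \<open>
  The integrand has a removable singularity at \<open>0\<close>, the starting point of the path. A single
  point of the path does not influence the integral, so the integrand may be replaced by the
  derivative of the termwise primitive.
\<close>

lemma contour_integral_power_series_over_id:
  assumes sums: "\<And>z. cmod z < 1 \<Longrightarrow> (\<lambda>n. a n * z ^ n) sums f z" and "a 0 = 0"
    and z: "cmod z < 1"
  shows "(\<lambda>n. a n / of_nat n * z ^ n) sums contour_integral (linepath 0 z) (\<lambda>t. f t / t)"
proof (cases "z = 0")
  case True
  have "(\<lambda>n. a n / of_nat n * 0 ^ n) sums (a 0 / of_nat 0)"
    by (rule powser_sums_zero)
  then show ?thesis using True by simp
next
  case False
  define P where "P w = (\<Sum>n. a n / of_nat n * w ^ n)" for w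
  have P: "(\<lambda>n. a n / of_nat n * w ^ n) sums P w" if w: "cmod w < 1" for w
    unfolding P_def
  proof (rule summable_sums, rule summable_comparison_test')
    define x where "x = (cmod w + 1) / 2"
    have "summable (\<lambda>n. a n * of_real x ^ n)"
      using sums[of "of_real x"] w by (auto simp: sums_iff x_def)
    then show "summable (\<lambda>n. cmod (a n * w ^ n))"
      by (rule powser_insidea) (use w in \<open>simp add: x_def\<close>)
    show "cmod (a n / of_nat n * w ^ n) \<le> cmod (a n * w ^ n)" if "n \<ge> 1" for n
      using that mult_right_mono[of 1 "real n" "cmod (a n * w ^ n)"]
      by (simp add: norm_mult norm_divide field_simps)
  qed
  have deriv_P: "deriv P w = f w / w" if w: "cmod w < 1" "w \<noteq> 0" for w
  proof -
    have "(\<lambda>n. w * (diffs (\<lambda>n. a n / of_nat n) n * w ^ n)) sums (w * deriv P w)"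
      by (intro sums_mult deriv_power_series_on_disc P w)
    moreover have "w * (diffs (\<lambda>n. a n / of_nat n) n * w ^ n) = a (Suc n) * w ^ Suc n" for n
      by (simp add: diffs_def del: of_nat_Suc)
    ultimately have "(\<lambda>n. a (Suc n) * w ^ Suc n) sums (w * deriv P w)"
      by simp
    then have "(\<lambda>n. a n * w ^ n) sums (w * deriv P w)"
      by (subst (asm) sums_Suc_iff) (simp add: \<open>a 0 = 0\<close>)
    then have "w * deriv P w = f w"
      using sums[OF w(1)] by (rule sums_unique2)
    then show ?thesis using w by (simp add: field_simps)
  qed
  have path: "path_image (linepath 0 z) \<subseteq> unit_disc"
    using z by (simp add: closed_segment_subset)
  have "(deriv P has_contour_integral (P z - P 0)) (linepath 0 z)"
  proof -
    have "(P has_field_derivative deriv P w) (at w within unit_disc)" if "w \<in> unit_disc" for w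
      by (rule has_field_derivative_at_within, rule deriv_power_series_on_disc(1)[OF P])
         (use that in auto)
    from contour_integral_primitive[OF this _ path] show ?thesis by simp
  qed
  moreover have "contour_integral (linepath 0 z) (\<lambda>t. f t / t)
      = contour_integral (linepath 0 z) (deriv P)"
    using path False
    by (intro contour_integral_spike_finite_simple_path[of "{0}"])
       (auto simp: deriv_P subset_iff)
  moreover have "P 0 = 0"
    using sums_unique2[OF P[of 0] powser_sums_zero] by simp
  ultimately show ?thesis
    using P[OF z] by (simp add: contour_integral_unique)
qed

lemma class_N_power_series:
  assumes \<alpha>: "0 \<le> \<alpha>" "\<alpha> \<le> 1" and F: "F \<in> class_N \<alpha>"
  obtains b where "b 0 = 0" "b 1 = 1" "\<And>n. n \<ge> 1 \<Longrightarrow> cmod (b n) \<le> (1 - \<alpha>) * real n + \<alpha>"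
    "\<And>z. cmod z < 1 \<Longrightarrow> (\<lambda>n. b n * z ^ n) sums F z"
proof -
  obtain f where f: "f \<in> class_A" and bound: "\<forall>n\<ge>2. cmod (taylor_coeff f n) \<le> real n"
    and F_eq: "\<forall>z\<in>unit_disc. F z = (1 - of_real \<alpha>) * f z
        + of_real \<alpha> * contour_integral (linepath 0 z) (\<lambda>t. f t / t)"
    using F by (auto simp: class_N_def)
  obtain a where a: "a 0 = 0" "a 1 = 1"
    and sums: "\<And>z. cmod z < 1 \<Longrightarrow> (\<lambda>n. a n * z ^ n) sums f z"
    using f by (auto simp: class_A_iff_power_series)
  define b where "b n = (of_real (1 - \<alpha>) + of_real \<alpha> / of_nat n) * a n" for n
  show thesis
  proof
    show "b 0 = 0" "b 1 = 1" using a by (simp_all add: b_def)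
  next
    fix n :: nat assume n: "n \<ge> 1"
    have "taylor_coeff f n = a n"
      using sums by (rule power_series_on_disc)
    then have "cmod (a n) \<le> real n"
      using bound[rule_format, of n] a n by (cases "n = 1") auto
    moreover have "of_real (1 - \<alpha>) + of_real \<alpha> / of_nat n = (of_real (1 - \<alpha> + \<alpha> / real n) :: complex)"
      by simp
    then have "cmod (b n) = (1 - \<alpha> + \<alpha> / real n) * cmod (a n)"
      using \<alpha> unfolding b_def norm_mult by (simp del: of_real_add of_real_divide of_real_diff)
    ultimately have "cmod (b n) \<le> (1 - \<alpha> + \<alpha> / real n) * real n"
      using \<alpha> by (simp add: mult_left_mono)
    also have "\<dots> = (1 - \<alpha>) * real n + \<alpha>"
      using n by (simp add: field_simps)
    finally show "cmod (b n) \<le> (1 - \<alpha>) * real n + \<alpha>" .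
  next
    fix z :: complex assume z: "cmod z < 1"
    have "(\<lambda>n. (1 - of_real \<alpha>) * (a n * z ^ n) + of_real \<alpha> * (a n / of_nat n * z ^ n)) sums F z"
      using F_eq z
      by (simp only: mem_ball_0)
         (intro sums_add sums_mult sums contour_integral_power_series_over_id a z)
    then show "(\<lambda>n. b n * z ^ n) sums F z"
      by (simp add: b_def algebra_simps)
  qed
qed

lemma dilation_in_class_A:
  assumes sums: "\<And>z. cmod z < 1 \<Longrightarrow> (\<lambda>n. a n * z ^ n) sums f z" and a: "a 0 = 0" "a 1 = 1"
    and r: "0 < r" "r \<le> 1"
  shows "dilation r f \<in> class_A"
proof -
  define b where "b n = a n * of_real r ^ n / of_real r" for n
  have "(\<lambda>n. b n * z ^ n) sums dilation r f z" if z: "cmod z < 1" for z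
  proof -
    have "cmod (of_real r * z) < 1"
      using mult_right_mono[of r 1 "cmod z"] r z by (simp add: norm_mult)
    from sums_divide[OF sums[OF this]] show ?thesis
      by (simp add: dilation_def b_def power_mult_distrib mult_ac)
  qed
  moreover have "b 0 = 0" "b 1 = 1" using a r by (simp_all add: b_def)
  ultimately show ?thesis
    by (subst class_A_iff_power_series) blast
qed

lemma inj_on_dilation_iff:
  assumes "0 < r"
  shows "inj_on (dilation r f) unit_disc \<longleftrightarrow> inj_on f (ball 0 r)"
proof -
  have image: "(\<lambda>z. of_real r * z) ` unit_disc = (ball 0 r :: complex set)"
    using ball_scale[of r "0 :: complex" 1] assms by (simp add: scaleR_conv_of_real[abs_def])
  have "inj_on (dilation r f) unit_disc \<longleftrightarrow> inj_on (f \<circ> (\<lambda>z. of_real r * z)) unit_disc"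
    using assms by (simp add: inj_on_def dilation_def)
  also have "\<dots> \<longleftrightarrow> inj_on f ((\<lambda>z. of_real r * z) ` unit_disc)"
    using assms by (intro comp_inj_on_iff[symmetric]) (simp add: inj_on_def)
  finally show ?thesis by (simp add: image)
qed

section \<open>The majorant of the derivatives\<close>

text \<open>The closed form of \<open>\<Sum> n c\<^sub>n x\<^sup>n\<^sup>-\<^sup>1\<close> with \<open>c\<^sub>n = (1 - \<alpha>) n + \<alpha>\<close>.\<close>

definition majorant :: "real \<Rightarrow> real \<Rightarrow> real" where
  "majorant \<alpha> x = (1 - \<alpha>) * (1 + x) / (1 - x) ^ 3 + \<alpha> / (1 - x) ^ 2"

lemma sums_n_mult_power:
  fixes z :: "'a :: {real_normed_field,banach}"
  assumes "norm z < 1"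
  shows "(\<lambda>n. of_nat n * z ^ n) sums (z / (1 - z) ^ 2)"
proof -
  have "(\<lambda>n. of_nat (Suc n) * z ^ Suc n) sums (z / (1 - z) ^ 2)"
    using sums_mult[OF geometric_deriv_sums[OF assms], of z] by (simp add: algebra_simps)
  then show ?thesis by (subst (asm) sums_Suc_iff) simp
qed

text \<open>
  Differentiating \<open>\<Sum> c\<^sub>n x\<^sup>n\<close> termwise: with the constant term \<open>c\<^sub>0 = \<alpha>\<close> this sum is
  \<open>(1 - \<alpha>) x / (1 - x)\<^sup>2 + \<alpha> / (1 - x)\<close>, a combination of the geometric series and of
  \<open>\<Sum> n x\<^sup>n\<close>.
\<close>

lemma majorant_sums:
  assumes x: "\<bar>x\<bar> < 1"
  shows "(\<lambda>n. diffs (\<lambda>n. (1 - \<alpha>) * real n + \<alpha>) n * x ^ n) sums majorant \<alpha> x"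
proof (rule termdiffs_sums_strong)
  fix y :: real assume y: "norm y < 1"
  have "(\<lambda>n. (1 - \<alpha>) * (real n * y ^ n) + \<alpha> * y ^ n) sums
          ((1 - \<alpha>) * (y / (1 - y) ^ 2) + \<alpha> * (1 / (1 - y)))"
    using y by (intro sums_add sums_mult sums_n_mult_power geometric_sums)
  then show "(\<lambda>n. ((1 - \<alpha>) * real n + \<alpha>) * y ^ n) sums
          ((1 - \<alpha>) * (y / (1 - y) ^ 2) + \<alpha> * (1 / (1 - y)))"
    by (simp add: algebra_simps)
next
  have "1 - x \<noteq> 0" using x by auto
  then have "((\<lambda>y. (1 - \<alpha>) * (y / (1 - y) ^ 2) + \<alpha> * (1 / (1 - y))) has_field_derivative
      (1 - \<alpha>) * (((1 - x) ^ 2 + x * (2 * (1 - x))) / ((1 - x) ^ 2 * (1 - x) ^ 2))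
       + \<alpha> * (1 / ((1 - x) * (1 - x)))) (at x)"
    by (auto intro!: derivative_eq_intros simp: algebra_simps)
  moreover have "((1 - x) ^ 2 + x * (2 * (1 - x))) / ((1 - x) ^ 2 * (1 - x) ^ 2) = (1 + x) / (1 - x) ^ 3"
  proof -
    have "(1 - x) ^ 2 + x * (2 * (1 - x)) = (1 - x) * (1 + x)"
      by (simp add: power2_eq_square algebra_simps)
    moreover have "(1 - x) ^ 2 * (1 - x) ^ 2 = (1 - x) * (1 - x) ^ 3"
      by (simp add: power2_eq_square power3_eq_cube)
    ultimately show ?thesis using \<open>1 - x \<noteq> 0\<close> by simp
  qed
  ultimately have "((\<lambda>y. (1 - \<alpha>) * (y / (1 - y) ^ 2) + \<alpha> * (1 / (1 - y))) has_field_derivative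
      (1 - \<alpha>) * ((1 + x) / (1 - x) ^ 3) + \<alpha> * (1 / ((1 - x) * (1 - x)))) (at x)"
    by (simp only:)
  moreover have "(1 - \<alpha>) * ((1 + x) / (1 - x) ^ 3) + \<alpha> * (1 / ((1 - x) * (1 - x))) = majorant \<alpha> x"
    by (simp add: majorant_def power2_eq_square)
  ultimately show "((\<lambda>y. (1 - \<alpha>) * (y / (1 - y) ^ 2) + \<alpha> * (1 / (1 - y))) has_field_derivative
      majorant \<alpha> x) (at x)"
    by (simp only:)
qed (use x in simp)

lemma cubic_eq_majorant:
  assumes "x < 1"
  shows "2 * (1 - x) ^ 3 + (2 * \<alpha> - 1) * x - 1 = (1 - x) ^ 3 * (2 - majorant \<alpha> x)"
proof -
  define u where "u = 1 - x"
  have "u \<noteq> 0" and x: "x = 1 - u" using assms by (auto simp: u_def)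
  then show ?thesis
    unfolding majorant_def x by (simp add: field_simps power2_eq_square power3_eq_cube)
qed

text \<open>
  In terms of \<open>u = 1 / (1 - x)\<close> the majorant equals \<open>u\<^sup>2 (1 + 2 (1 - \<alpha>) (u - 1))\<close>, a product of
  increasing positive factors, the first of them strictly increasing.
\<close>

lemma majorant_strict_mono:
  assumes "\<alpha> \<le> 1" "0 \<le> x" "x < y" "y < 1"
  shows "majorant \<alpha> x < majorant \<alpha> y"
proof -
  have eq: "majorant \<alpha> t = (1 / (1 - t)) ^ 2 * (1 + 2 * (1 - \<alpha>) * (1 / (1 - t) - 1))" if "t < 1" for t
  proof -
    define v where "v = 1 - t"
    have "v \<noteq> 0" and t: "t = 1 - v" using that by (auto simp: v_def)
    then show ?thesis
      unfolding majorant_def t by (simp add: field_simps power2_eq_square power3_eq_cube)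
  qed
  define u v where "u = 1 / (1 - x)" and "v = 1 / (1 - y)"
  have "1 \<le> u" "u < v" using assms by (auto simp: u_def v_def divide_simps)
  define k where "k = 2 * (1 - \<alpha>)"
  have "k \<ge> 0" using assms by (simp add: k_def)
  have "u ^ 2 < v ^ 2" using \<open>1 \<le> u\<close> \<open>u < v\<close> by (intro power_strict_mono) auto
  moreover have "k * (u - 1) \<le> k * (v - 1)" "0 \<le> k * (u - 1)"
    using \<open>k \<ge> 0\<close> \<open>1 \<le> u\<close> \<open>u < v\<close> by (auto intro!: mult_left_mono)
  ultimately have "u ^ 2 * (1 + k * (u - 1)) < v ^ 2 * (1 + k * (v - 1))"
    using \<open>1 \<le> u\<close> by (intro mult_less_le_imp_less) auto
  then show ?thesis using assms by (simp only: eq u_def v_def k_def)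
qed

lemma ex1_majorant_eq_2:
  assumes "\<alpha> \<le> 1"
  shows "\<exists>!x. x \<in> {0<..<1} \<and> majorant \<alpha> x = 2"
proof -
  define p where "p x = 2 * (1 - x) ^ 3 + (2 * \<alpha> - 1) * x - 1" for x :: real
  \<comment> \<open>At \<open>1\<close> the cubic vanishes if \<open>\<alpha> = 1\<close>, while at \<open>1/2\<close> it is at most \<open>- 1/4\<close>.\<close>
  have "\<exists>x\<ge>0. x \<le> 1/2 \<and> p x = 0"
    using assms by (intro IVT2') (auto simp: p_def power3_eq_cube intro!: continuous_intros)
  then obtain x where x: "0 \<le> x" "x \<le> 1/2" "p x = 0" by blast
  moreover have "x \<noteq> 0" using x by (auto simp: p_def)
  ultimately have "x \<in> {0<..<1}" "majorant \<alpha> x = 2"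
    using cubic_eq_majorant[of x \<alpha>] by (auto simp: p_def)
  moreover have "y = x" if "y \<in> {0<..<1}" "majorant \<alpha> y = 2" for y
    using majorant_strict_mono[OF assms, of x y] majorant_strict_mono[OF assms, of y x] that calculation
    by (cases x y rule: linorder_cases) simp_all
  ultimately show ?thesis by blast
qed

section \<open>Injectivity inside the radius\<close>

text \<open>
  The leading terms \<open>b\<^sub>1 = c\<^sub>1 = 1\<close> cancel on both sides; the remaining terms of the two
  differentiated series are compared one by one.
\<close>

lemma cmod_deriv_minus_one_le:
  assumes sums: "\<And>z. cmod z < 1 \<Longrightarrow> (\<lambda>n. b n * z ^ n) sums F z" and "b 1 = 1"
    and bound: "\<And>n. n \<ge> 1 \<Longrightarrow> cmod (b n) \<le> (1 - \<alpha>) * real n + \<alpha>"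
    and z: "cmod z \<le> \<rho>" "\<rho> < 1"
  shows "cmod (deriv F z - 1) \<le> majorant \<alpha> \<rho> - 1"
proof -
  define c where "c n = (1 - \<alpha>) * real n + \<alpha>" for n
  have \<rho>: "0 \<le> \<rho>" "\<bar>\<rho>\<bar> < 1" using z norm_ge_zero[of z] by linarith+
  have "(\<lambda>n. diffs b n * z ^ n) sums deriv F z"
    using sums z by (intro deriv_power_series_on_disc) auto
  then have "(\<lambda>n. diffs b (Suc n) * z ^ Suc n) sums (deriv F z - 1)"
    by (subst sums_Suc_iff) (use \<open>b 1 = 1\<close> in \<open>simp add: diffs_def\<close>)
  moreover have "(\<lambda>n. diffs c n * \<rho> ^ n) sums majorant \<alpha> \<rho>"
    unfolding c_def using \<rho>(2) by (rule majorant_sums)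
  then have "(\<lambda>n. diffs c (Suc n) * \<rho> ^ Suc n) sums (majorant \<alpha> \<rho> - 1)"
    by (subst sums_Suc_iff) (simp add: diffs_def c_def)
  moreover have "cmod (diffs b (Suc n) * z ^ Suc n) \<le> diffs c (Suc n) * \<rho> ^ Suc n" for n
  proof -
    have b: "cmod (b (Suc (Suc n))) \<le> c (Suc (Suc n))"
      using bound[of "Suc (Suc n)"] by (simp add: c_def)
    then have "0 \<le> c (Suc (Suc n))"
      by (rule order_trans[OF norm_ge_zero])
    with b z \<rho> show ?thesis
      unfolding diffs_def norm_mult norm_power norm_of_nat
      by (intro mult_mono power_mono mult_nonneg_nonneg) auto
  qed
  ultimately show ?thesis by (rule norm_sums_le)
qed

text \<open>By the mean value inequality, \<open>f z - z\<close> contracts distances on \<open>S\<close> by the factor \<open>k\<close>.\<close>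

lemma inj_on_if_deriv_close_to_one:
  assumes "convex S"
    and D: "\<And>z. z \<in> S \<Longrightarrow> (f has_field_derivative f' z) (at z within S)"
    and close: "\<And>z. z \<in> S \<Longrightarrow> norm (f' z - 1) \<le> k" and "k < 1"
  shows "inj_on f S"
proof (rule inj_onI)
  fix z w assume zw: "z \<in> S" "w \<in> S" "f z = f w"
  have "((\<lambda>z. f z - z) has_field_derivative f' z - 1) (at z within S)" if "z \<in> S" for z
    by (intro DERIV_diff D that DERIV_ident)
  from field_differentiable_bound[OF \<open>convex S\<close> this close zw(1,2)]
  have "norm (z - w) \<le> k * norm (z - w)"
    using zw(3) by (simp add: norm_minus_commute)
  then show "z = w"
    using \<open>k < 1\<close> by (cases "z = w") (auto simp: mult_le_cancel_right1)
qed

text \<open>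
  At the radius itself the contraction constant reaches \<open>1\<close>, so the contraction argument is
  applied to the closed disc that is just large enough to contain two given points.
\<close>

lemma inj_on_ball_of_majorant:
  assumes sums: "\<And>z. cmod z < 1 \<Longrightarrow> (\<lambda>n. b n * z ^ n) sums F z" and "b 1 = 1"
    and bound: "\<And>n. n \<ge> 1 \<Longrightarrow> cmod (b n) \<le> (1 - \<alpha>) * real n + \<alpha>"
    and \<alpha>: "\<alpha> \<le> 1" and r: "r < 1" "majorant \<alpha> r = 2"
  shows "inj_on F (ball 0 r)"
proof (rule inj_onI)
  fix z w assume zw: "z \<in> ball 0 r" "w \<in> ball 0 r" "F z = F w"
  define \<rho> where "\<rho> = max (cmod z) (cmod w)"
  have \<rho>: "0 \<le> \<rho>" "\<rho> < r" using zw by (auto simp: \<rho>_def le_max_iff_disj)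
  have "inj_on F (cball 0 \<rho>)"
  proof (rule inj_on_if_deriv_close_to_one)
    fix t :: complex assume t: "t \<in> cball 0 \<rho>"
    show "(F has_field_derivative deriv F t) (at t within cball 0 \<rho>)"
      by (rule has_field_derivative_at_within, rule deriv_power_series_on_disc(1)[OF sums])
         (use t \<rho> r in auto)
    show "cmod (deriv F t - 1) \<le> majorant \<alpha> \<rho> - 1"
      using t \<rho> r by (intro cmod_deriv_minus_one_le[OF sums \<open>b 1 = 1\<close> bound]) auto
  next
    show "majorant \<alpha> \<rho> - 1 < 1"
      using majorant_strict_mono[OF \<alpha> \<rho> r(1)] r(2) by simp
  qed simp
  then show "z = w"
    using zw(3) by (rule inj_onD) (auto simp: \<rho>_def)
qed

section \<open>The extremal function\<close>

text \<open>
  The function \<open>2 z - z / (1 - z)\<^sup>2\<close>, the Koebe function with the signs of the higher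
  coefficients reversed, generates the extremal function.
\<close>

lemma extremal_in_class_N: "extremal \<alpha> \<in> class_N \<alpha>"
proof -
  define f where "f z = 2 * z - z / (1 - z) ^ 2" for z :: complex
  define a :: "nat \<Rightarrow> complex" where "a n = (if n = 1 then 2 else 0) - of_nat n" for n
  have linear: "(\<lambda>n. (if n = 1 then 2 else 0) * z ^ n) sums (2 * z)" for z :: complex
    using sums_single[of 1 "\<lambda>n. 2 * z ^ n"] by (simp add: if_distrib[of "\<lambda>x. x * _"] cong: if_cong)
  have sums: "(\<lambda>n. a n * z ^ n) sums f z" if "cmod z < 1" for z
    using sums_diff[OF linear sums_n_mult_power[OF that]] by (simp add: a_def f_def algebra_simps)
  have "f \<in> class_A"
    using sums by (subst class_A_iff_power_series) (auto intro!: exI[of _ a] simp: a_def)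
  moreover have "cmod (taylor_coeff f n) \<le> real n" if "n \<ge> 2" for n
    using power_series_on_disc(2)[of a f n] sums that by (simp add: a_def)
  moreover have "contour_integral (linepath 0 z) (\<lambda>t. f t / t) = 2 * z - z / (1 - z)"
    if z: "cmod z < 1" for z
  proof -
    have "(\<lambda>n. a n / of_nat n * z ^ n) sums contour_integral (linepath 0 z) (\<lambda>t. f t / t)"
      by (rule contour_integral_power_series_over_id[OF sums _ z]) (simp_all add: a_def)
    moreover have "(\<lambda>n. z ^ Suc n) sums (z / (1 - z))"
      using sums_mult[OF geometric_sums[OF z], of z] by simp
    then have "(\<lambda>n. if n = 0 then 0 else z ^ n) sums (z / (1 - z))"
      using sums_Suc_iff[of "\<lambda>n. if n = 0 then 0 else z ^ n"] by simp
    from sums_diff[OF linear this]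
    have "(\<lambda>n. a n / of_nat n * z ^ n) sums (2 * z - z / (1 - z))"
      by (rule back_subst[of "\<lambda>g. g sums _"]) (auto simp: a_def fun_eq_iff field_simps)
    ultimately show ?thesis by (rule sums_unique2)
  qed
  moreover have "extremal \<alpha> z = (1 - of_real \<alpha>) * f z + of_real \<alpha> * (2 * z - z / (1 - z))" for z
    by (simp add: extremal_def f_def algebra_simps diff_divide_distrib)
  ultimately show ?thesis
    unfolding class_N_def by (intro CollectI bexI[of _ f]) auto
qed

lemma extremal_has_field_derivative:
  assumes "x < 1"
  shows "(extremal \<alpha> has_field_derivative of_real (2 - majorant \<alpha> x)) (at (of_real x))"
proof -
  define c \<beta> where "c = complex_of_real x" and "\<beta> = complex_of_real \<alpha>"
  have "1 - c = of_real (1 - x)" by (simp add: c_def)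
  then have c: "1 - c \<noteq> 0" using assms by (simp only: of_real_eq_0_iff)
  have "(extremal \<alpha> has_field_derivative
      2 - (\<beta> * (1 - c) + \<beta> * c) / ((1 - c) * (1 - c))
        - ((1 - \<beta>) * (1 - c) ^ 2 + (1 - \<beta>) * c * (2 * (1 - c))) / ((1 - c) ^ 2 * (1 - c) ^ 2)) (at c)"
    unfolding extremal_def[abs_def] \<beta>_def[symmetric] using c
    by (auto intro!: derivative_eq_intros simp: algebra_simps)
  moreover have "\<beta> * (1 - c) + \<beta> * c = \<beta>" by (simp add: algebra_simps)
  moreover have "((1 - \<beta>) * (1 - c) ^ 2 + (1 - \<beta>) * c * (2 * (1 - c))) / ((1 - c) ^ 2 * (1 - c) ^ 2)
      = (1 - \<beta>) * (1 + c) / (1 - c) ^ 3"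
  proof -
    have "(1 - \<beta>) * (1 - c) ^ 2 + (1 - \<beta>) * c * (2 * (1 - c)) = (1 - c) * ((1 - \<beta>) * (1 + c))"
      by (simp add: power2_eq_square algebra_simps)
    moreover have "(1 - c) ^ 2 * (1 - c) ^ 2 = (1 - c) * (1 - c) ^ 3"
      by (simp add: power2_eq_square power3_eq_cube)
    ultimately show ?thesis using c by simp
  qed
  ultimately have "(extremal \<alpha> has_field_derivative
      2 - \<beta> / ((1 - c) * (1 - c)) - (1 - \<beta>) * (1 + c) / (1 - c) ^ 3) (at c)"
    by (simp only:)
  moreover have "2 - \<beta> / ((1 - c) * (1 - c)) - (1 - \<beta>) * (1 + c) / (1 - c) ^ 3
      = of_real (2 - majorant \<alpha> x)"
    by (simp add: majorant_def c_def \<beta>_def power2_eq_square)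
  ultimately show ?thesis
    by (simp only: c_def)
qed

lemma extremal_not_inj_on:
  assumes "0 \<le> r0" "majorant \<alpha> r0 = 2" "r0 < r" "r \<le> 1"
  shows "\<not> inj_on (extremal \<alpha>) (ball 0 r)"
proof
  assume inj: "inj_on (extremal \<alpha>) (ball 0 r)"
  have "extremal \<alpha> holomorphic_on ball 0 r"
    unfolding extremal_def[abs_def] using assms by (intro holomorphic_intros) auto
  \<comment> \<open>The derivative \<open>2 - majorant \<alpha> r0\<close> at the interior point \<open>r0\<close> is \<open>0\<close>.\<close>
  from holomorphic_injective_imp_regular[OF this _ inj, of "of_real r0"]
  have "deriv (extremal \<alpha>) (of_real r0) \<noteq> 0"
    using assms by simp
  moreover have "deriv (extremal \<alpha>) (of_real r0) = 0"
    using DERIV_imp_deriv[OF extremal_has_field_derivative[of r0 \<alpha>]] assms by simp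
  ultimately show False by contradiction
qed

section \<open>The radius\<close>

lemma radius_eqI: "is_radius G F r0 \<Longrightarrow> radius G F = r0"
  unfolding radius_def by (rule the_equality) (auto simp: is_radius_def intro: antisym)

lemma is_radius_class_S_class_N:
  assumes \<alpha>: "0 \<le> \<alpha>" "\<alpha> \<le> 1" and r0: "0 < r0" "r0 < 1" "majorant \<alpha> r0 = 2"
  shows "is_radius class_S (class_N \<alpha>) r0"
  unfolding is_radius_def
proof (intro conjI allI impI)
  have "dilation r F \<in> class_S" if F: "F \<in> class_N \<alpha>" and r: "0 < r" "r \<le> r0" for F r
  proof -
    obtain b where b: "b 0 = 0" "b 1 = 1" "\<And>n. n \<ge> 1 \<Longrightarrow> cmod (b n) \<le> (1 - \<alpha>) * real n + \<alpha>"
      "\<And>z. cmod z < 1 \<Longrightarrow> (\<lambda>n. b n * z ^ n) sums F z"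
      using class_N_power_series[OF \<alpha> F] by blast
    have "dilation r F \<in> class_A"
      using r r0 by (intro dilation_in_class_A[OF b(4,1,2)]) auto
    moreover have "inj_on F (ball 0 r0)"
      using inj_on_ball_of_majorant[OF b(4,2,3) \<alpha>(2) r0(2,3)] .
    then have "inj_on F (ball 0 r)"
      by (rule inj_on_subset) (use r in auto)
    ultimately show ?thesis
      using r by (simp add: class_S_def inj_on_dilation_iff)
  qed
  then show "radius_admissible class_S (class_N \<alpha>) r0"
    using r0 by (simp add: radius_admissible_def)
next
  fix s assume s: "radius_admissible class_S (class_N \<alpha>) s"
  show "s \<le> r0"
  proof (rule ccontr)
    assume "\<not> s \<le> r0"
    then have "0 < s" "r0 < s" "s \<le> 1"
      using s r0 by (auto simp: radius_admissible_def)
    moreover from this have "dilation s (extremal \<alpha>) \<in> class_S"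
      using s extremal_in_class_N by (simp add: radius_admissible_def)
    ultimately have "inj_on (extremal \<alpha>) (ball 0 s)"
      by (simp add: class_S_def inj_on_dilation_iff)
    with extremal_not_inj_on[of r0 \<alpha> s] r0 \<open>r0 < s\<close> \<open>s \<le> 1\<close> show False by simp
  qed
qed

theorem theorem3:
  fixes \<alpha> :: real
  assumes "0 \<le> \<alpha>" and "\<alpha> \<le> 1"
  shows "is_radius class_S (class_N \<alpha>) (r_S \<alpha>)
    \<and> (\<exists>!r::real. r \<in> {0<..<1} \<and> 2 * (1 - r) ^ 3 + (2 * \<alpha> - 1) * r - 1 = 0)
    \<and> r_S \<alpha> \<in> {0<..<1}
    \<and> 2 * (1 - r_S \<alpha>) ^ 3 + (2 * \<alpha> - 1) * r_S \<alpha> - 1 = 0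
    \<and> extremal \<alpha> \<in> class_N \<alpha>
    \<and> (\<forall>r. r_S \<alpha> < r \<and> r \<le> 1 \<longrightarrow> \<not> inj_on (extremal \<alpha>) (ball 0 r))"
proof -
  have root_iff: "2 * (1 - r) ^ 3 + (2 * \<alpha> - 1) * r - 1 = 0 \<longleftrightarrow> majorant \<alpha> r = 2"
    if "r \<in> {0<..<1}" for r
    using that cubic_eq_majorant[of r \<alpha>] by simp
  have ex1: "\<exists>!r. r \<in> {0<..<1} \<and> majorant \<alpha> r = 2"
    using assms(2) by (rule ex1_majorant_eq_2)
  then obtain r0 where r0: "r0 \<in> {0<..<1}" "majorant \<alpha> r0 = 2" by blast
  have radius: "is_radius class_S (class_N \<alpha>) r0"
    using assms r0 by (intro is_radius_class_S_class_N) auto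
  then have r_S: "r_S \<alpha> = r0"
    unfolding r_S_def by (rule radius_eqI)
  have "\<exists>!r. r \<in> {0<..<1} \<and> 2 * (1 - r) ^ 3 + (2 * \<alpha> - 1) * r - 1 = 0"
    using ex1 root_iff by (simp only: cong: conj_cong)
  moreover have "\<forall>r. r0 < r \<and> r \<le> 1 \<longrightarrow> \<not> inj_on (extremal \<alpha>) (ball 0 r)"
    using r0 extremal_not_inj_on[of r0 \<alpha>] by auto
  moreover have "2 * (1 - r0) ^ 3 + (2 * \<alpha> - 1) * r0 - 1 = 0"
    using root_iff[OF r0(1)] r0(2) by blast
  ultimately show ?thesis
    unfolding r_S using radius r0(1) extremal_in_class_N by blast
qed

end
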